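(* Let $G$ be a connected real $4$-dimensional Lie group and let $\{X_1,X_2,X_3,X_4\}$ be a global basis of left invariant vector fields on $G$ (determining its Lie algebra). Let $g$ be the left invariant pseudo-Riemannian metric with $g(X_1,X_1)=g(X_2,X_2)=-g(X_3,X_3)=-g(X_4,X_4)=1$ and $g(X_i,X_j)=0$ for $i\neq j$, and let $P$ be the left invariant almost product structure given by $PX_1=X_1$, $PX_2=X_2$, $PX_3=-X_3$, $PX_4=-X_4$. Then $(G,P,g)$ is a $\mathcal{W}_3$-manifold with Killing metric $g$ if and only if there exist real numbers $\lambda_1,\lambda_2,\lambda_3,\lambda_4$ such that \[ \begin{aligned} [X_1,X_2]&=\lambda_2X_3-\lambda_1X_4, & [X_2,X_3]&=-\lambda_2X_1-\lambda_3X_4,\\ [X_1,X_3]&=\lambda_2X_2+\lambda_4X_4, & [X_2,X_4]&=\lambda_1X_1+\lambda_3X_3,\\ [X_1,X_4]&=-\lambda_1X_2-\lambda_4X_3, & [X_3,X_4]&=-\lambda_4X_1+\lambda_3X_2 . \end{aligned} \]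
   Context: An almost product structure on a manifold is a $(1,1)$-tensor field $P$ with $P^2=\mathrm{id}$; together with a metric $g$ satisfying $g(Px,Py)=g(x,y)$ it gives a (pseudo-)Riemannian almost product manifold. Let $\nabla$ be the Levi-Civita connection of $g$ and $F(x,y,z)=g((\nabla_xP)y,z)$. The manifold is a $\mathcal{W}_3$-manifold if $F(x,y,z)+F(y,z,x)+F(z,x,y)=0$ for all $x,y,z$. A left invariant metric $g$ on a Lie group $G$ is called a Killing metric if $g([X,Y],Z)+g([X,Z],Y)=0$ for all left invariant vector fields $X,Y,Z$. *)

theory Defs
  imports "HOL-Analysis.Analysis" "HOL-Library.Function_Algebras"
begin

section \<open>Pointwise real vector space structure on functions\<close>

text \<open>Together with \<^theory>\<open>HOL-Library.Function_Algebras\<close> this makes real functions, tangent vectors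
  and vector fields (as represented below) elements of real vector spaces.\<close>

instantiation "fun" :: (type, real_vector) real_vector
begin

definition scaleR_fun_def: "c *\<^sub>R f = (\<lambda>x. c *\<^sub>R f x)"

instance
  by standard (auto simp: scaleR_fun_def fun_eq_iff scaleR_add_right scaleR_add_left)

end

lemma scaleR_fun_apply [simp]: "(c *\<^sub>R f) x = c *\<^sub>R f x"
  by (simp add: scaleR_fun_def)


section \<open>Smooth maps between open subsets of Euclidean spaces\<close>

text \<open>Meaningful for open \<open>S\<close>, the only case used below.\<close>

primrec Ck_on :: "nat \<Rightarrow> 'e::euclidean_space set \<Rightarrow> ('e \<Rightarrow> 'f::euclidean_space) \<Rightarrow> bool" where
  "Ck_on 0 S f \<longleftrightarrow> continuous_on S f"
| "Ck_on (Suc k) S f \<longleftrightarrow>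
     (\<forall>x\<in>S. f differentiable (at x)) \<and> (\<forall>v. Ck_on k S (\<lambda>x. frechet_derivative f (at x) v))"

definition smooth_on :: "'e::euclidean_space set \<Rightarrow> ('e \<Rightarrow> 'f::euclidean_space) \<Rightarrow> bool" where
  "smooth_on S f \<longleftrightarrow> (\<forall>k. Ck_on k S f)"


section \<open>Smooth manifolds and Lie groups\<close>

text \<open>The manifold is the whole type \<^typ>\<open>'a\<close>; its smooth structure is given by an atlas of charts
  with values in the model space \<^typ>\<open>'e\<close>, whose dimension is the dimension of the manifold.\<close>

type_synonym ('a, 'e) chart = "'a set \<times> ('a \<Rightarrow> 'e)"
type_synonym ('a, 'e) atlas = "('a, 'e) chart set"

definition smooth_atlas ::
  "('a::{t2_space,second_countable_topology}, 'e::euclidean_space) atlas \<Rightarrow> bool" where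
  "smooth_atlas A \<longleftrightarrow>
     (\<Union>(U, \<phi>)\<in>A. U) = UNIV \<and>
     (\<forall>(U, \<phi>)\<in>A. open U \<and> open (\<phi> ` U) \<and> homeomorphism U (\<phi> ` U) \<phi> (inv_into U \<phi>)) \<and>
     (\<forall>(U, \<phi>)\<in>A. \<forall>(V, \<psi>)\<in>A. smooth_on (\<phi> ` (U \<inter> V)) (\<psi> \<circ> inv_into U \<phi>))"

definition prod_atlas :: "('a, 'e) atlas \<Rightarrow> ('b, 'f) atlas \<Rightarrow> ('a \<times> 'b, 'e \<times> 'f) atlas" where
  "prod_atlas A B = {(U \<times> V, map_prod \<phi> \<psi>) | U \<phi> V \<psi>. (U, \<phi>) \<in> A \<and> (V, \<psi>) \<in> B}"

definition smooth_map ::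
  "('a::topological_space, 'e::euclidean_space) atlas \<Rightarrow>
   ('b::topological_space, 'f::euclidean_space) atlas \<Rightarrow> ('a \<Rightarrow> 'b) \<Rightarrow> bool" where
  "smooth_map A B F \<longleftrightarrow>
     continuous_on UNIV F \<and>
     (\<forall>(U, \<phi>)\<in>A. \<forall>(V, \<psi>)\<in>B. smooth_on (\<phi> ` (U \<inter> F -` V)) (\<psi> \<circ> F \<circ> inv_into U \<phi>))"

definition smooth_functions :: "('a, 'e::euclidean_space) atlas \<Rightarrow> ('a \<Rightarrow> real) set" where
  "smooth_functions A = {f. \<forall>(U, \<phi>)\<in>A. smooth_on (\<phi> ` U) (f \<circ> inv_into U \<phi>)}"

text \<open>The group law is written additively because \<^class>\<open>group_add\<close> is the type class of (not necessarily
  commutative) groups: \<open>a + p\<close> is the product of \<open>a\<close> and \<open>p\<close>.\<close>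

definition lie_group ::
  "('a::{t2_space,second_countable_topology,group_add}, 'e::euclidean_space) atlas \<Rightarrow> bool" where
  "lie_group A \<longleftrightarrow>
     smooth_atlas A \<and>
     smooth_map (prod_atlas A A) A (\<lambda>(p, q). p + q) \<and>
     smooth_map A A uminus"


section \<open>Tangent vectors and vector fields\<close>

text \<open>A tangent vector at \<open>p\<close> is a derivation at \<open>p\<close> of the algebra of smooth functions. Since HOL functions
  are total, it is extended by 0 to the non-smooth functions, so that equality of tangent vectors is
  equality on smooth functions.\<close>

type_synonym 'a tvec = "('a \<Rightarrow> real) \<Rightarrow> real"
type_synonym 'a vfield = "'a \<Rightarrow> 'a tvec"

definition tangent_space :: "('a, 'e::euclidean_space) atlas \<Rightarrow> 'a \<Rightarrow> 'a tvec set" where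
  "tangent_space A p = {v.
     (\<forall>f. f \<notin> smooth_functions A \<longrightarrow> v f = 0) \<and>
     (\<forall>f\<in>smooth_functions A. \<forall>h\<in>smooth_functions A. v (f + h) = v f + v h) \<and>
     (\<forall>c. \<forall>f\<in>smooth_functions A. v (c *\<^sub>R f) = c * v f) \<and>
     (\<forall>f\<in>smooth_functions A. \<forall>h\<in>smooth_functions A. v (f * h) = f p * v h + h p * v f)}"

definition smooth_vfields :: "('a, 'e::euclidean_space) atlas \<Rightarrow> 'a vfield set" where
  "smooth_vfields A = {X.
     (\<forall>p. X p \<in> tangent_space A p) \<and>
     (\<forall>f\<in>smooth_functions A. (\<lambda>p. X p f) \<in> smooth_functions A)}"

definition lie_bracket :: "'a vfield \<Rightarrow> 'a vfield \<Rightarrow> 'a vfield" where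
  "lie_bracket X Y = (\<lambda>p f. X p (\<lambda>q. Y q f) - Y p (\<lambda>q. X q f))"

text \<open>The differential of a smooth map \<open>F\<close> into the manifold with atlas \<open>B\<close>.\<close>

definition pushforward ::
  "('b, 'f::euclidean_space) atlas \<Rightarrow> ('a \<Rightarrow> 'b) \<Rightarrow> 'a tvec \<Rightarrow> 'b tvec" where
  "pushforward B F v = (\<lambda>f. if f \<in> smooth_functions B then v (f \<circ> F) else 0)"

abbreviation dL :: "('a::group_add, 'e::euclidean_space) atlas \<Rightarrow> 'a \<Rightarrow> 'a tvec \<Rightarrow> 'a tvec" where
  "dL A a \<equiv> pushforward A (\<lambda>q. a + q)"

definition left_invariant_vfields ::
  "('a::group_add, 'e::euclidean_space) atlas \<Rightarrow> 'a vfield set" where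
  "left_invariant_vfields A = {X \<in> smooth_vfields A. \<forall>a p. X (a + p) = dL A a (X p)}"

text \<open>A global basis of left invariant vector fields: left invariant fields whose values form a basis
  of the tangent space at every point.\<close>

definition left_invariant_basis ::
  "('a::group_add, 'e::euclidean_space) atlas \<Rightarrow> 'i set \<Rightarrow> ('i \<Rightarrow> 'a vfield) \<Rightarrow> bool" where
  "left_invariant_basis A I X \<longleftrightarrow>
     (\<forall>i\<in>I. X i \<in> left_invariant_vfields A) \<and>
     (\<forall>p. inj_on (\<lambda>i. X i p) I \<and>
          independent ((\<lambda>i. X i p) ` I) \<and>
          span ((\<lambda>i. X i p) ` I) = tangent_space A p)"


section \<open>Metrics and almost product structures\<close>

type_synonym 'a metric = "'a \<Rightarrow> 'a tvec \<Rightarrow> 'a tvec \<Rightarrow> real"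
type_synonym 'a tensor11 = "'a \<Rightarrow> 'a tvec \<Rightarrow> 'a tvec"

definition pseudo_riemannian_metric :: "('a, 'e::euclidean_space) atlas \<Rightarrow> 'a metric \<Rightarrow> bool" where
  "pseudo_riemannian_metric A g \<longleftrightarrow>
     (\<forall>p. \<forall>u\<in>tangent_space A p. \<forall>v\<in>tangent_space A p. g p u v = g p v u) \<and>
     (\<forall>p. \<forall>u\<in>tangent_space A p. \<forall>v\<in>tangent_space A p. \<forall>w\<in>tangent_space A p. \<forall>a b.
        g p (a *\<^sub>R u + b *\<^sub>R v) w = a * g p u w + b * g p v w) \<and>
     (\<forall>p. \<forall>u\<in>tangent_space A p. (\<forall>v\<in>tangent_space A p. g p u v = 0) \<longrightarrow> u = 0) \<and>
     (\<forall>X\<in>smooth_vfields A. \<forall>Y\<in>smooth_vfields A. (\<lambda>p. g p (X p) (Y p)) \<in> smooth_functions A)"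

definition left_invariant_metric ::
  "('a::group_add, 'e::euclidean_space) atlas \<Rightarrow> 'a metric \<Rightarrow> bool" where
  "left_invariant_metric A g \<longleftrightarrow>
     (\<forall>a p. \<forall>u\<in>tangent_space A p. \<forall>v\<in>tangent_space A p. g (a + p) (dL A a u) (dL A a v) = g p u v)"

definition killing_metric ::
  "('a::group_add, 'e::euclidean_space) atlas \<Rightarrow> 'a metric \<Rightarrow> bool" where
  "killing_metric A g \<longleftrightarrow>
     (\<forall>X\<in>left_invariant_vfields A. \<forall>Y\<in>left_invariant_vfields A. \<forall>Z\<in>left_invariant_vfields A. \<forall>p.
        g p (lie_bracket X Y p) (Z p) + g p (lie_bracket X Z p) (Y p) = 0)"

definition tensor11 :: "('a, 'e::euclidean_space) atlas \<Rightarrow> 'a tensor11 \<Rightarrow> bool" where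
  "tensor11 A P \<longleftrightarrow>
     (\<forall>p. \<forall>u\<in>tangent_space A p. P p u \<in> tangent_space A p) \<and>
     (\<forall>p. \<forall>u\<in>tangent_space A p. \<forall>v\<in>tangent_space A p. \<forall>a b.
        P p (a *\<^sub>R u + b *\<^sub>R v) = a *\<^sub>R P p u + b *\<^sub>R P p v) \<and>
     (\<forall>X\<in>smooth_vfields A. (\<lambda>p. P p (X p)) \<in> smooth_vfields A)"

definition left_invariant_tensor11 ::
  "('a::group_add, 'e::euclidean_space) atlas \<Rightarrow> 'a tensor11 \<Rightarrow> bool" where
  "left_invariant_tensor11 A P \<longleftrightarrow>
     (\<forall>a p. \<forall>u\<in>tangent_space A p. P (a + p) (dL A a u) = dL A a (P p u))"

definition almost_product_structure :: "('a, 'e::euclidean_space) atlas \<Rightarrow> 'a tensor11 \<Rightarrow> bool" where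
  "almost_product_structure A P \<longleftrightarrow>
     tensor11 A P \<and> (\<forall>p. \<forall>u\<in>tangent_space A p. P p (P p u) = u)"

definition almost_product_manifold ::
  "('a::{t2_space,second_countable_topology}, 'e::euclidean_space) atlas \<Rightarrow>
   'a tensor11 \<Rightarrow> 'a metric \<Rightarrow> bool" where
  "almost_product_manifold A P g \<longleftrightarrow>
     smooth_atlas A \<and> almost_product_structure A P \<and> pseudo_riemannian_metric A g \<and>
     (\<forall>p. \<forall>u\<in>tangent_space A p. \<forall>v\<in>tangent_space A p. g p (P p u) (P p v) = g p u v)"


section \<open>Levi-Civita connection and the class W3\<close>

type_synonym 'a connection = "'a vfield \<Rightarrow> 'a vfield \<Rightarrow> 'a vfield"

definition affine_connection :: "('a, 'e::euclidean_space) atlas \<Rightarrow> 'a connection \<Rightarrow> bool" where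
  "affine_connection A D \<longleftrightarrow>
     (\<forall>X\<in>smooth_vfields A. \<forall>Y\<in>smooth_vfields A. D X Y \<in> smooth_vfields A) \<and>
     (\<forall>X\<in>smooth_vfields A. \<forall>Y\<in>smooth_vfields A. \<forall>Z\<in>smooth_vfields A.
        D (X + Y) Z = D X Z + D Y Z \<and> D X (Y + Z) = D X Y + D X Z) \<and>
     (\<forall>f\<in>smooth_functions A. \<forall>X\<in>smooth_vfields A. \<forall>Y\<in>smooth_vfields A.
        D (\<lambda>p. f p *\<^sub>R X p) Y = (\<lambda>p. f p *\<^sub>R D X Y p) \<and>
        D X (\<lambda>p. f p *\<^sub>R Y p) = (\<lambda>p. X p f *\<^sub>R Y p + f p *\<^sub>R D X Y p))"

definition is_levi_civita :: "('a, 'e::euclidean_space) atlas \<Rightarrow> 'a metric \<Rightarrow> 'a connection \<Rightarrow> bool" where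
  "is_levi_civita A g D \<longleftrightarrow>
     affine_connection A D \<and>
     (\<forall>X\<in>smooth_vfields A. \<forall>Y\<in>smooth_vfields A. D X Y - D Y X = lie_bracket X Y) \<and>
     (\<forall>X\<in>smooth_vfields A. \<forall>Y\<in>smooth_vfields A. \<forall>Z\<in>smooth_vfields A. \<forall>p.
        X p (\<lambda>q. g q (Y q) (Z q)) = g p (D X Y p) (Z p) + g p (Y p) (D X Z p))"

text \<open>By the fundamental theorem of pseudo-Riemannian geometry such a connection exists and is unique on
  smooth vector fields; choice (rather than definite description) is used only because HOL operators are
  also defined, arbitrarily, on arguments that are not smooth vector fields.\<close>

definition levi_civita :: "('a, 'e::euclidean_space) atlas \<Rightarrow> 'a metric \<Rightarrow> 'a connection" where
  "levi_civita A g = (SOME D. is_levi_civita A g D)"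

definition covariant_derivative_tensor11 ::
  "'a connection \<Rightarrow> 'a tensor11 \<Rightarrow> 'a vfield \<Rightarrow> 'a vfield \<Rightarrow> 'a vfield" where
  "covariant_derivative_tensor11 D P X Y =
     D X (\<lambda>p. P p (Y p)) - (\<lambda>p. P p (D X Y p))"

definition F_tensor ::
  "('a, 'e::euclidean_space) atlas \<Rightarrow> 'a tensor11 \<Rightarrow> 'a metric \<Rightarrow>
   'a vfield \<Rightarrow> 'a vfield \<Rightarrow> 'a vfield \<Rightarrow> 'a \<Rightarrow> real" where
  "F_tensor A P g X Y Z = (\<lambda>p. g p (covariant_derivative_tensor11 (levi_civita A g) P X Y p) (Z p))"

definition W3_manifold ::
  "('a::{t2_space,second_countable_topology}, 'e::euclidean_space) atlas \<Rightarrow>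
   'a tensor11 \<Rightarrow> 'a metric \<Rightarrow> bool" where
  "W3_manifold A P g \<longleftrightarrow>
     almost_product_manifold A P g \<and>
     (\<forall>X\<in>smooth_vfields A. \<forall>Y\<in>smooth_vfields A. \<forall>Z\<in>smooth_vfields A.
        F_tensor A P g X Y Z + F_tensor A P g Y Z X + F_tensor A P g Z X Y = 0)"

end

theory Submission
  imports Defs
begin

text \<open>Put \<open>C i j k = g [X i, X j] (X k)\<close>; by left invariance it is constant. The metric is Killing iff
  \<open>C\<close> is totally skew, and on four indices a totally skew \<open>C\<close> is given by the four numbers
  \<open>C 1 2 3, C 1 2 4, C 1 3 4, C 2 3 4\<close>, which are the \<open>\<lambda>\<close>s up to sign and order. The class \<open>W3\<close> imposes nothing
  more: for a Killing metric the Levi-Civita connection satisfies \<open>\<nabla> (X i) (X j) = [X i, X j] / 2\<close>, so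
  that \<open>F (X i) (X j) (X k) = (\<sigma> j - \<sigma> k) C i j k / 2\<close>, where \<open>P (X i) = \<sigma> i X i\<close>, and the cyclic sum
  cancels because \<open>C\<close> is invariant under cyclic permutations.\<close>

section \<open>Smooth functions and their derivations\<close>

text \<open>An open set is a neighbourhood of each of its points, so derivatives at points of
  \<open>S\<close> only see values on \<open>S\<close>. This licenses rewriting inside
  \<open>Ck_on\<close> with derivative formulas that are valid on \<open>S\<close> alone.\<close>

lemma Ck_on_cong:
  assumes "open S" and "\<And>x. x \<in> S \<Longrightarrow> f x = h x"
  shows "Ck_on k S f \<longleftrightarrow> Ck_on k S h"
  using assms(2)
proof (induction k arbitrary: f h)
  case 0
  then show ?case by (auto intro: continuous_on_cong)
next
  case (Suc k)
  have D: "(f has_derivative L) (at x) \<longleftrightarrow> (h has_derivative L) (at x)" if "x \<in> S" for x L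
    using Suc.prems that assms(1)
    by (metis has_derivative_transform_within_open)
  then have "f differentiable (at x) \<longleftrightarrow> h differentiable (at x)" if "x \<in> S" for x
    using that by (simp add: differentiable_def)
  moreover have "frechet_derivative f (at x) = frechet_derivative h (at x)" if "x \<in> S" for x
    using D that by (simp add: frechet_derivative_def)
  then have "Ck_on k S (\<lambda>x. frechet_derivative f (at x) v)
      \<longleftrightarrow> Ck_on k S (\<lambda>x. frechet_derivative h (at x) v)" for v
    by (intro Suc.IH) simp
  ultimately show ?case by simp
qed

lemma Ck_on_SucD: "Ck_on (Suc k) S f \<Longrightarrow> Ck_on k S f"
proof (induction k arbitrary: f)
  case 0
  then show ?case
    by (auto intro!: continuous_at_imp_continuous_on differentiable_imp_continuous_within)
qed auto

lemma Ck_on_const: "Ck_on k S (\<lambda>_. c)"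
  by (induction k arbitrary: c) auto

lemma Ck_on_add:
  assumes "open S" and "Ck_on k S f" and "Ck_on k S h"
  shows "Ck_on k S (\<lambda>x. f x + h x)"
  using assms(2,3)
proof (induction k arbitrary: f h)
  case 0
  then show ?case by (auto intro: continuous_on_add)
next
  case (Suc k)
  have D: "frechet_derivative (\<lambda>x. f x + h x) (at x)
      = (\<lambda>v. frechet_derivative f (at x) v + frechet_derivative h (at x) v)" if "x \<in> S" for x
    using Suc.prems that
    by (intro frechet_derivative_at[symmetric] has_derivative_add iffD1[OF frechet_derivative_works]) auto
  show ?case
    using Suc by (auto simp: D cong: Ck_on_cong[OF assms(1)])
qed

lemma Ck_on_mult:
  fixes f h :: "'e::euclidean_space \<Rightarrow> real"
  assumes "open S" and "Ck_on k S f" and "Ck_on k S h"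
  shows "Ck_on k S (\<lambda>x. f x * h x)"
  using assms(2,3)
proof (induction k arbitrary: f h)
  case 0
  then show ?case by (auto intro: continuous_on_mult)
next
  case (Suc k)
  have D: "frechet_derivative (\<lambda>x. f x * h x) (at x)
      = (\<lambda>v. f x * frechet_derivative h (at x) v + frechet_derivative f (at x) v * h x)"
    if "x \<in> S" for x
    using Suc.prems that
    by (intro frechet_derivative_at[symmetric] has_derivative_mult iffD1[OF frechet_derivative_works]) auto
  \<comment> \<open>The product rule leaves one factor undifferentiated, so the factors themselves
    must be lowered from class \<open>Suc k\<close> to class \<open>k\<close> before the induction
    hypothesis applies.\<close>
  have "Ck_on k S f" "Ck_on k S h"
    using Suc.prems by (auto intro: Ck_on_SucD)
  then show ?case
    using Suc by (auto simp: D cong: Ck_on_cong[OF assms(1)] intro!: Ck_on_add[OF assms(1)])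
qed

section \<open>The algebra of smooth functions on a manifold and its derivations\<close>

context
  fixes A :: "('a::{t2_space,second_countable_topology}, 'e::euclidean_space) atlas"
begin

lemma smooth_functions_const: "(\<lambda>_. c) \<in> smooth_functions A"
  by (auto simp: smooth_functions_def smooth_on_def o_def Ck_on_const)

context
  assumes atlas: "smooth_atlas A"
begin

lemma open_chart_image: "(U, \<phi>) \<in> A \<Longrightarrow> open (\<phi> ` U)"
  using atlas by (auto simp: smooth_atlas_def)

lemma smooth_functions_add:
  "f \<in> smooth_functions A \<Longrightarrow> h \<in> smooth_functions A \<Longrightarrow> (\<lambda>p. f p + h p) \<in> smooth_functions A"
  using open_chart_image
  by (fastforce simp: smooth_functions_def smooth_on_def o_def intro: Ck_on_add)

lemma smooth_functions_mult:
  "f \<in> smooth_functions A \<Longrightarrow> h \<in> smooth_functions A \<Longrightarrow> (\<lambda>p. f p * h p) \<in> smooth_functions A"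
  using open_chart_image
  by (fastforce simp: smooth_functions_def smooth_on_def o_def intro: Ck_on_mult)

lemma smooth_functions_diff:
  "f \<in> smooth_functions A \<Longrightarrow> h \<in> smooth_functions A \<Longrightarrow> (\<lambda>p. f p - h p) \<in> smooth_functions A"
  using smooth_functions_add[OF _ smooth_functions_mult[OF smooth_functions_const[of "-1"]], of f h]
  by simp

lemma smooth_functions_sum:
  "(\<And>i. i \<in> I \<Longrightarrow> f i \<in> smooth_functions A) \<Longrightarrow> (\<lambda>p. \<Sum>i\<in>I. f i p) \<in> smooth_functions A"
  by (induction I rule: infinite_finite_induct)
    (auto intro: smooth_functions_const smooth_functions_add)

end

context
  fixes p :: 'a and v :: "'a tvec"
  assumes v: "v \<in> tangent_space A p"
begin

lemma tangent_not_smooth: "f \<notin> smooth_functions A \<Longrightarrow> v f = 0"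
  using v by (auto simp: tangent_space_def)

lemma tangent_add:
  "f \<in> smooth_functions A \<Longrightarrow> h \<in> smooth_functions A \<Longrightarrow> v (\<lambda>q. f q + h q) = v f + v h"
  using v by (auto simp: tangent_space_def plus_fun_def)

lemma tangent_scale: "f \<in> smooth_functions A \<Longrightarrow> v (\<lambda>q. c * f q) = c * v f"
  using v by (auto simp: tangent_space_def scaleR_fun_def)

lemma tangent_mult:
  "f \<in> smooth_functions A \<Longrightarrow> h \<in> smooth_functions A \<Longrightarrow>
    v (\<lambda>q. f q * h q) = f p * v h + h p * v f"
  using v by (auto simp: tangent_space_def times_fun_def)

text \<open>The Leibniz rule on \<open>1 * 1\<close> gives \<open>v 1 = 2 * v 1\<close>, hence
  \<open>v 1 = 0\<close>; scaling does the rest.\<close>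

lemma tangent_const: "v (\<lambda>_. c) = 0"
proof -
  have "v (\<lambda>_. 1) = 0"
    using tangent_mult[OF smooth_functions_const[of 1] smooth_functions_const[of 1]] by simp
  then show ?thesis
    using tangent_scale[OF smooth_functions_const[of 1], of c] by simp
qed

lemma tangent_sum:
  assumes "smooth_atlas A" and "\<And>i. i \<in> I \<Longrightarrow> f i \<in> smooth_functions A"
  shows "v (\<lambda>q. \<Sum>i\<in>I. f i q) = (\<Sum>i\<in>I. v (f i))"
  using assms(2)
  by (induction I rule: infinite_finite_induct)
    (auto simp: tangent_const tangent_add smooth_functions_sum[OF assms(1)])

end

end

section \<open>Vector fields and their brackets\<close>

lemma sum_fun_apply: "(\<Sum>i\<in>I. f i) x = (\<Sum>i\<in>I. f i x)"
  for f :: "'i \<Rightarrow> 'b \<Rightarrow> 'c::comm_monoid_add"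
  by (induction I rule: infinite_finite_induct) auto

lemma lie_bracket_skew: "lie_bracket Y X = - lie_bracket X Y"
  by (simp add: lie_bracket_def fun_eq_iff)

lemma smooth_vfieldsD:
  assumes "Y \<in> smooth_vfields A"
  shows "Y p \<in> tangent_space A p" and "f \<in> smooth_functions A \<Longrightarrow> (\<lambda>p. Y p f) \<in> smooth_functions A"
  using assms by (auto simp: smooth_vfields_def)

text \<open>On a product \<open>f * h\<close> the mixed terms \<open>Y f * Z h\<close> and
  \<open>Z f * Y h\<close> cancel by antisymmetry, which leaves the Leibniz rule. On a non-smooth
  \<open>f\<close> the inner functions are constantly 0, so the convention of extension by 0 is
  kept.\<close>

lemma lie_bracket_smooth:
  fixes A :: "('a::{t2_space,second_countable_topology}, 'e::euclidean_space) atlas"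
  assumes atlas: "smooth_atlas A" and Y: "Y \<in> smooth_vfields A" and Z: "Z \<in> smooth_vfields A"
  shows "lie_bracket Y Z \<in> smooth_vfields A"
proof -
  note sf = smooth_functions_add[OF atlas] smooth_functions_mult[OF atlas]
    smooth_functions_const smooth_vfieldsD(2)[OF Y] smooth_vfieldsD(2)[OF Z]
  note tY = smooth_vfieldsD(1)[OF Y] and tZ = smooth_vfieldsD(1)[OF Z]
  note tan = tangent_add[OF tY] tangent_add[OF tZ] tangent_mult[OF tY] tangent_mult[OF tZ]
    tangent_scale[OF tY] tangent_scale[OF tZ]
  have "lie_bracket Y Z p \<in> tangent_space A p" for p
    unfolding tangent_space_def
    by (auto simp: lie_bracket_def plus_fun_def times_fun_def scaleR_fun_def sf tan
        tangent_const[OF tY] tangent_const[OF tZ] tangent_not_smooth[OF tY] tangent_not_smooth[OF tZ]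
        algebra_simps)
  moreover have "(\<lambda>p. lie_bracket Y Z p f) \<in> smooth_functions A" if "f \<in> smooth_functions A" for f
    unfolding lie_bracket_def using that by (intro smooth_functions_diff[OF atlas] sf)
  ultimately show ?thesis by (simp add: smooth_vfields_def)
qed

text \<open>On smooth functions, left invariance means commuting with precomposition by left
  translations, and this property passes to composites and differences of operators.\<close>

lemma lie_bracket_left_invariant:
  fixes A :: "('a::{t2_space,second_countable_topology,group_add}, 'e::euclidean_space) atlas"
  assumes atlas: "smooth_atlas A"
    and Y: "Y \<in> left_invariant_vfields A" and Z: "Z \<in> left_invariant_vfields A"
  shows "lie_bracket Y Z \<in> left_invariant_vfields A"
proof -
  have Y': "Y \<in> smooth_vfields A" "Y (a + p) = dL A a (Y p)" for a p
    using Y by (auto simp: left_invariant_vfields_def)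
  have Z': "Z \<in> smooth_vfields A" "Z (a + p) = dL A a (Z p)" for a p
    using Z by (auto simp: left_invariant_vfields_def)
  note bracket = lie_bracket_smooth[OF atlas Y'(1) Z'(1)]
  have "lie_bracket Y Z (a + p) f = dL A a (lie_bracket Y Z p) f" for a p f
  proof (cases "f \<in> smooth_functions A")
    case True
    have "(\<lambda>q. Y q f) \<circ> (\<lambda>q. a + q) = (\<lambda>q. Y q (f \<circ> (\<lambda>q. a + q)))"
      "(\<lambda>q. Z q f) \<circ> (\<lambda>q. a + q) = (\<lambda>q. Z q (f \<circ> (\<lambda>q. a + q)))"
      using True by (simp_all add: fun_eq_iff Y'(2) Z'(2) pushforward_def)
    then show ?thesis
      using True smooth_vfieldsD(2)[OF Y'(1) True] smooth_vfieldsD(2)[OF Z'(1) True]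
      unfolding lie_bracket_def by (simp add: Y'(2) Z'(2) pushforward_def)
  next
    case False
    then show ?thesis
      using tangent_not_smooth[OF smooth_vfieldsD(1)[OF bracket]] by (simp add: pushforward_def)
  qed
  then show ?thesis
    using bracket unfolding left_invariant_vfields_def by blast
qed

section \<open>Left invariant orthonormal frames\<close>

locale left_invariant_orthonormal_frame =
  fixes A :: "('a::{t2_space,second_countable_topology,group_add}, 'e::euclidean_space) atlas"
    and I :: "'i set" and X :: "'i \<Rightarrow> 'a vfield" and g :: "'a metric" and \<epsilon> :: "'i \<Rightarrow> real"
  assumes atlas: "smooth_atlas A" and finite_I [simp]: "finite I"
    and basis: "left_invariant_basis A I X"
    and metric: "pseudo_riemannian_metric A g" and inv_metric: "left_invariant_metric A g"
    and orthonormal: "i \<in> I \<Longrightarrow> j \<in> I \<Longrightarrow> g p (X i p) (X j p) = (if i = j then \<epsilon> i else 0)"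
    and eps_sq [simp]: "i \<in> I \<Longrightarrow> \<epsilon> i * \<epsilon> i = 1"
begin

text \<open>Since \<open>\<epsilon> i\<close> is its own inverse, this is the coefficient of
  \<open>X i p\<close> in \<open>u\<close>, with no division by the norm of the frame
  vector.\<close>

definition coord :: "'i \<Rightarrow> 'a \<Rightarrow> 'a tvec \<Rightarrow> real"
  where "coord i p u = \<epsilon> i * g p u (X i p)"

text \<open>Here 0 is the neutral element of the additively written group. Keeping the last index
  lowered by \<open>g\<close> turns the Killing condition into plain skew-symmetry.\<close>

definition C :: "'i \<Rightarrow> 'i \<Rightarrow> 'i \<Rightarrow> real"
  where "C i j k = g 0 (lie_bracket (X i) (X j) 0) (X k 0)"

lemma X_left_invariant: "i \<in> I \<Longrightarrow> X i \<in> left_invariant_vfields A"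
  using basis by (auto simp: left_invariant_basis_def)

lemma X_smooth: "i \<in> I \<Longrightarrow> X i \<in> smooth_vfields A"
  using X_left_invariant by (auto simp: left_invariant_vfields_def)

lemma X_tangent: "i \<in> I \<Longrightarrow> X i p \<in> tangent_space A p"
  by (rule smooth_vfieldsD(1)[OF X_smooth])

lemma tangent_space_eq_span: "tangent_space A p = span ((\<lambda>i. X i p) ` I)"
  using basis by (auto simp: left_invariant_basis_def)

text \<open>The frame spans the tangent space, so the closure rules are those of
  \<open>span\<close>.\<close>

lemma tangent_space_closed [intro]:
  "u \<in> tangent_space A p \<Longrightarrow> w \<in> tangent_space A p \<Longrightarrow> u + w \<in> tangent_space A p"
  "u \<in> tangent_space A p \<Longrightarrow> w \<in> tangent_space A p \<Longrightarrow> u - w \<in> tangent_space A p"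
  "u \<in> tangent_space A p \<Longrightarrow> c *\<^sub>R u \<in> tangent_space A p"
  "0 \<in> tangent_space A p"
  "(\<And>j. j \<in> J \<Longrightarrow> f j \<in> tangent_space A p) \<Longrightarrow> sum f J \<in> tangent_space A p"
  unfolding tangent_space_eq_span
  by (auto intro: span_add span_diff span_scale span_zero span_sum)

section \<open>Bilinearity of the metric and coordinates in the frame\<close>

lemma g_sym:
  "u \<in> tangent_space A p \<Longrightarrow> w \<in> tangent_space A p \<Longrightarrow> g p u w = g p w u"
  using metric by (simp add: pseudo_riemannian_metric_def)

lemma g_linear:
  "u \<in> tangent_space A p \<Longrightarrow> v \<in> tangent_space A p \<Longrightarrow> w \<in> tangent_space A p \<Longrightarrow>
    g p (a *\<^sub>R u + b *\<^sub>R v) w = a * g p u w + b * g p v w"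
  using metric unfolding pseudo_riemannian_metric_def by blast

lemma g_add:
  "u \<in> tangent_space A p \<Longrightarrow> v \<in> tangent_space A p \<Longrightarrow> w \<in> tangent_space A p \<Longrightarrow>
    g p (u + v) w = g p u w + g p v w"
  using g_linear[of u p v w 1 1] by simp

lemma g_scale:
  "u \<in> tangent_space A p \<Longrightarrow> w \<in> tangent_space A p \<Longrightarrow> g p (c *\<^sub>R u) w = c * g p u w"
  using g_linear[of u p u w c 0] by simp

lemma g_diff:
  "u \<in> tangent_space A p \<Longrightarrow> v \<in> tangent_space A p \<Longrightarrow> w \<in> tangent_space A p \<Longrightarrow>
    g p (u - v) w = g p u w - g p v w"
  using g_linear[of u p v w 1 "-1"] by simp

lemma g_zero: "w \<in> tangent_space A p \<Longrightarrow> g p 0 w = 0"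
  using g_scale[of w p w 0] by simp

lemma g_minus:
  "u \<in> tangent_space A p \<Longrightarrow> w \<in> tangent_space A p \<Longrightarrow> g p (- u) w = - g p u w"
  using g_scale[of u p w "-1"] by simp

lemma g_sum:
  assumes "w \<in> tangent_space A p" and "\<And>j. j \<in> J \<Longrightarrow> f j \<in> tangent_space A p"
  shows "g p (sum f J) w = (\<Sum>j\<in>J. g p (f j) w)"
  using assms(2)
  by (induction J rule: infinite_finite_induct)
    (auto simp: g_zero g_add tangent_space_closed(5) assms(1))

lemma g_smooth:
  "Y \<in> smooth_vfields A \<Longrightarrow> Z \<in> smooth_vfields A \<Longrightarrow>
    (\<lambda>p. g p (Y p) (Z p)) \<in> smooth_functions A"
  using metric by (simp add: pseudo_riemannian_metric_def)

lemma coord_add: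
  "i \<in> I \<Longrightarrow> u \<in> tangent_space A p \<Longrightarrow> w \<in> tangent_space A p \<Longrightarrow>
    coord i p (u + w) = coord i p u + coord i p w"
  by (simp add: coord_def g_add X_tangent algebra_simps)

lemma coord_scale:
  "i \<in> I \<Longrightarrow> u \<in> tangent_space A p \<Longrightarrow> coord i p (c *\<^sub>R u) = c * coord i p u"
  by (simp add: coord_def g_scale X_tangent)

lemma coord_zero: "i \<in> I \<Longrightarrow> coord i p 0 = 0"
  by (simp add: coord_def g_zero X_tangent)

lemma coord_X: "i \<in> I \<Longrightarrow> j \<in> I \<Longrightarrow> coord i p (X j p) = (if i = j then 1 else 0)"
  by (simp add: coord_def orthonormal)

lemma coord_smooth: "i \<in> I \<Longrightarrow> Y \<in> smooth_vfields A \<Longrightarrow> (\<lambda>p. coord i p (Y p)) \<in> smooth_functions A"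
  unfolding coord_def
  by (intro smooth_functions_mult[OF atlas] smooth_functions_const g_smooth X_smooth)

lemma g_X: "k \<in> I \<Longrightarrow> g p u (X k p) = \<epsilon> k * coord k p u"
  by (simp add: coord_def mult.assoc[symmetric])

text \<open>The vectors equal to their expansion form a subspace; it contains the frame vectors and
  therefore their span, the whole tangent space.\<close>

lemma expand:
  assumes "u \<in> tangent_space A p"
  shows "u = (\<Sum>i\<in>I. coord i p u *\<^sub>R X i p)"
proof -
  have "subspace {u \<in> tangent_space A p. u = (\<Sum>i\<in>I. coord i p u *\<^sub>R X i p)}" (is "subspace ?S")
    unfolding subspace_def
  proof (intro conjI ballI allI)
    show "0 \<in> ?S" using tangent_space_closed(4) by (simp add: coord_zero)
  next
    fix u w assume uw: "u \<in> ?S" "w \<in> ?S"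
    then have "(\<Sum>i\<in>I. coord i p (u + w) *\<^sub>R X i p)
        = (\<Sum>i\<in>I. coord i p u *\<^sub>R X i p) + (\<Sum>i\<in>I. coord i p w *\<^sub>R X i p)"
      by (simp add: coord_add scaleR_add_left sum.distrib)
    then show "u + w \<in> ?S" using uw by auto
  next
    fix c u assume u: "u \<in> ?S"
    then have "u \<in> tangent_space A p" by simp
    then have "(\<Sum>i\<in>I. coord i p (c *\<^sub>R u) *\<^sub>R X i p) = c *\<^sub>R (\<Sum>i\<in>I. coord i p u *\<^sub>R X i p)"
      by (simp add: coord_scale scaleR_sum_right)
    then show "c *\<^sub>R u \<in> ?S" using u by auto
  qed
  moreover have "(\<lambda>i. X i p) ` I \<subseteq> ?S"
  proof clarify
    fix j assume j: "j \<in> I"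
    have "(\<Sum>i\<in>I. coord i p (X j p) *\<^sub>R X i p) = (\<Sum>i\<in>I. if i = j then X i p else 0)"
      using j by (intro sum.cong) (auto simp: coord_X)
    then show "X j p \<in> tangent_space A p \<and> X j p = (\<Sum>i\<in>I. coord i p (X j p) *\<^sub>R X i p)"
      using j by (simp add: X_tangent)
  qed
  ultimately have "span ((\<lambda>i. X i p) ` I) \<subseteq> ?S"
    by (rule span_minimal[rotated])
  then show ?thesis
    using assms tangent_space_eq_span by blast
qed

lemma expand_apply:
  assumes "u \<in> tangent_space A p"
  shows "u f = (\<Sum>i\<in>I. coord i p u * X i p f)"
  using fun_cong[OF expand[OF assms], of f] by (simp add: sum_fun_apply)

lemma g_expand:
  assumes "u \<in> tangent_space A p" and "w \<in> tangent_space A p"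
  shows "g p u w = (\<Sum>i\<in>I. \<epsilon> i * coord i p u * coord i p w)"
proof -
  have "g p u w = g p (\<Sum>i\<in>I. coord i p u *\<^sub>R X i p) w"
    using expand[OF assms(1)] by simp
  also have "\<dots> = (\<Sum>i\<in>I. coord i p u * g p (X i p) w)"
    using assms by (simp add: g_sum g_scale tangent_space_closed(3) X_tangent)
  also have "\<dots> = (\<Sum>i\<in>I. \<epsilon> i * coord i p u * coord i p w)"
    using assms by (intro sum.cong refl) (simp add: g_sym[of "X _ p" p w] X_tangent g_X)
  finally show ?thesis .
qed

lemma tangent_eqI:
  assumes "u \<in> tangent_space A p" "w \<in> tangent_space A p" "\<And>i. i \<in> I \<Longrightarrow> coord i p u = coord i p w"
  shows "u = w"
  by (subst expand[OF assms(1)], subst expand[OF assms(2)]) (simp add: assms(3))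

text \<open>Left translation by \<open>p\<close> carries the values at the neutral element to those
  at \<open>p\<close> and preserves the metric. This is what makes structure constants and
  coordinates of left invariant fields constant.\<close>

lemma g_left_invariant:
  assumes "Y \<in> left_invariant_vfields A" and "Z \<in> left_invariant_vfields A"
  shows "g p (Y p) (Z p) = g 0 (Y 0) (Z 0)"
proof -
  have "g (p + 0) (dL A p (Y 0)) (dL A p (Z 0)) = g 0 (Y 0) (Z 0)"
    using inv_metric assms unfolding left_invariant_metric_def
    by (metis (no_types, lifting) left_invariant_vfields_def mem_Collect_eq smooth_vfieldsD(1))
  moreover have "dL A p (Y 0) = Y (p + 0)" "dL A p (Z 0) = Z (p + 0)"
    using assms by (simp_all only: left_invariant_vfields_def mem_Collect_eq)
  ultimately show ?thesis by simp
qed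

section \<open>Brackets of the frame fields and their structure constants\<close>

lemma bracket_smooth: "i \<in> I \<Longrightarrow> j \<in> I \<Longrightarrow> lie_bracket (X i) (X j) \<in> smooth_vfields A"
  by (intro lie_bracket_smooth atlas X_smooth)

lemma bracket_tangent: "i \<in> I \<Longrightarrow> j \<in> I \<Longrightarrow> lie_bracket (X i) (X j) p \<in> tangent_space A p"
  by (rule smooth_vfieldsD(1)[OF bracket_smooth])

lemma g_bracket: "i \<in> I \<Longrightarrow> j \<in> I \<Longrightarrow> k \<in> I \<Longrightarrow> g p (lie_bracket (X i) (X j) p) (X k p) = C i j k"
  unfolding C_def
  by (intro g_left_invariant lie_bracket_left_invariant atlas X_left_invariant)

lemma g_bracket_expand:
  assumes "i \<in> I" "j \<in> I" "w \<in> tangent_space A p"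
  shows "g p (lie_bracket (X i) (X j) p) w = (\<Sum>k\<in>I. C i j k * coord k p w)"
proof -
  have "\<epsilon> k * coord k p (lie_bracket (X i) (X j) p) = C i j k" if "k \<in> I" for k
    using g_X[OF that, of p "lie_bracket (X i) (X j) p"] assms that by (simp add: g_bracket)
  then show ?thesis
    using assms by (simp add: g_expand bracket_tangent)
qed

lemma C_skew: "i \<in> I \<Longrightarrow> j \<in> I \<Longrightarrow> k \<in> I \<Longrightarrow> C j i k = - C i j k"
  by (simp add: C_def lie_bracket_skew[of "X j"] g_minus bracket_tangent X_tangent)

text \<open>The factor \<open>\<epsilon> k\<close> raises the last index of \<open>C\<close>
  again.\<close>

lemma bracket_expand:
  assumes "i \<in> I" "j \<in> I"
  shows "lie_bracket (X i) (X j) = (\<Sum>k\<in>I. (\<epsilon> k * C i j k) *\<^sub>R X k)"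
proof
  fix p
  show "lie_bracket (X i) (X j) p = (\<Sum>k\<in>I. (\<epsilon> k * C i j k) *\<^sub>R X k) p"
    using assms expand[OF bracket_tangent[OF assms, of p]]
    by (simp add: sum_fun_apply coord_def g_bracket)
qed

text \<open>The bracket is not tensorial: expanding both fields in the frame and applying the
  Leibniz rule leaves derivatives of the coordinates beside a bilinear part in the frame
  brackets.\<close>

lemma lie_bracket_expand:
  assumes Y: "Y \<in> smooth_vfields A" and Z: "Z \<in> smooth_vfields A"
  shows "lie_bracket Y Z p =
    (\<Sum>j\<in>I. (Y p (\<lambda>q. coord j q (Z q)) - Z p (\<lambda>q. coord j q (Y q))) *\<^sub>R X j p)
    + (\<Sum>i\<in>I. \<Sum>j\<in>I. (coord i p (Y p) * coord j p (Z p)) *\<^sub>R lie_bracket (X i) (X j) p)"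
    (is "_ = ?R")
proof
  fix f
  show "lie_bracket Y Z p f = ?R f"
  proof (cases "f \<in> smooth_functions A")
    case False
    then show ?thesis
      by (simp add: sum_fun_apply tangent_not_smooth[OF X_tangent]
          tangent_not_smooth[OF bracket_tangent]
          tangent_not_smooth[OF smooth_vfieldsD(1)[OF lie_bracket_smooth[OF atlas Y Z]]])
  next
    case f: True
    have Xf: "(\<lambda>q. X j q f) \<in> smooth_functions A" if "j \<in> I" for j
      by (rule smooth_vfieldsD(2)[OF X_smooth[OF that] f])
    \<comment> \<open>The iterated derivative splits into a first-order part and a second-order
      part; only the latter contributes frame brackets after antisymmetrization.\<close>
    have *: "V p (\<lambda>q. W q f) = (\<Sum>j\<in>I. V p (\<lambda>q. coord j q (W q)) * X j p f)
        + (\<Sum>i\<in>I. \<Sum>j\<in>I. coord i p (V p) * coord j p (W p) * X i p (\<lambda>q. X j q f))"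
      if V: "V \<in> smooth_vfields A" and W: "W \<in> smooth_vfields A" for V W
    proof -
      note Vp = smooth_vfieldsD(1)[OF V, of p]
      have "W q f = (\<Sum>j\<in>I. coord j q (W q) * X j q f)" for q
        by (rule expand_apply[OF smooth_vfieldsD(1)[OF W]])
      then have "V p (\<lambda>q. W q f) = (\<Sum>j\<in>I. V p (\<lambda>q. coord j q (W q) * X j q f))"
        using W by (simp add: tangent_sum[OF Vp atlas] smooth_functions_mult[OF atlas] coord_smooth Xf)
      also have "\<dots> = (\<Sum>j\<in>I. V p (\<lambda>q. coord j q (W q)) * X j p f)
          + (\<Sum>j\<in>I. coord j p (W p) * V p (\<lambda>q. X j q f))"
        using W by (simp add: tangent_mult[OF Vp] coord_smooth Xf sum.distrib algebra_simps)
      also have "(\<Sum>j\<in>I. coord j p (W p) * V p (\<lambda>q. X j q f))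
          = (\<Sum>j\<in>I. \<Sum>i\<in>I. coord i p (V p) * coord j p (W p) * X i p (\<lambda>q. X j q f))"
        by (subst expand_apply[OF Vp]) (simp add: sum_distrib_left mult_ac)
      also have "\<dots> = (\<Sum>i\<in>I. \<Sum>j\<in>I. coord i p (V p) * coord j p (W p) * X i p (\<lambda>q. X j q f))"
        by (rule sum.swap)
      finally show ?thesis .
    qed
    \<comment> \<open>Exchanging the index names in the second-order part of \<open>Z (Y f)\<close>
      gives it the same coefficients as that of \<open>Y (Z f)\<close>, so the difference is a sum
      of frame brackets.\<close>
    have "(\<Sum>i\<in>I. \<Sum>j\<in>I. coord i p (Z p) * coord j p (Y p) * X i p (\<lambda>q. X j q f))
        = (\<Sum>i\<in>I. \<Sum>j\<in>I. coord i p (Y p) * coord j p (Z p) * X j p (\<lambda>q. X i q f))"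
      by (subst sum.swap) (simp add: mult_ac)
    then have "lie_bracket Y Z p f =
        (\<Sum>j\<in>I. (Y p (\<lambda>q. coord j q (Z q)) - Z p (\<lambda>q. coord j q (Y q))) * X j p f)
        + (\<Sum>i\<in>I. \<Sum>j\<in>I. coord i p (Y p) * coord j p (Z p) * lie_bracket (X i) (X j) p f)"
      by (simp add: lie_bracket_def *[OF Y Z] *[OF Z Y] sum_subtractf algebra_simps)
    then show ?thesis by (simp add: sum_fun_apply)
  qed
qed

section \<open>The Levi-Civita connection of a Killing metric\<close>

text \<open>The Killing condition ranges over all left invariant fields, but these have constant
  coordinates, so \<open>g [U, V] W\<close> is trilinear in the coordinates with coefficients
  \<open>C\<close>.\<close>

lemma killing_metric_iff:
  "killing_metric A g \<longleftrightarrow> (\<forall>i\<in>I. \<forall>j\<in>I. \<forall>k\<in>I. C i k j = - C i j k)"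
proof
  assume K: "killing_metric A g"
  show "\<forall>i\<in>I. \<forall>j\<in>I. \<forall>k\<in>I. C i k j = - C i j k"
  proof (intro ballI)
    fix i j k assume "i \<in> I" "j \<in> I" "k \<in> I"
    then have "C i j k + C i k j = 0"
      using K X_left_invariant unfolding killing_metric_def C_def by blast
    then show "C i k j = - C i j k" by simp
  qed
next
  assume C: "\<forall>i\<in>I. \<forall>j\<in>I. \<forall>k\<in>I. C i k j = - C i j k"
  have bracket: "g p (lie_bracket U V p) (W p) = (\<Sum>i\<in>I. \<Sum>j\<in>I. \<Sum>k\<in>I.
      coord i p (U p) * coord j p (V p) * coord k p (W p) * C i j k)"
    if U: "U \<in> left_invariant_vfields A" and V: "V \<in> left_invariant_vfields A"
      and W: "W \<in> left_invariant_vfields A" for U V W p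
  proof -
    have sm: "U \<in> smooth_vfields A" "V \<in> smooth_vfields A" "W \<in> smooth_vfields A"
      using U V W by (auto simp: left_invariant_vfields_def)
    note Wp = smooth_vfieldsD(1)[OF sm(3), of p]
    \<comment> \<open>Coordinates of a left invariant field are constant, and tangent vectors
      annihilate constants; this kills the derivative terms of
      \<open>lie_bracket_expand\<close>.\<close>
    have const: "T' p (\<lambda>q. coord j q (T q)) = 0"
      if "j \<in> I" "T \<in> left_invariant_vfields A" "T' \<in> smooth_vfields A" for j T T'
    proof -
      have "(\<lambda>q. coord j q (T q)) = (\<lambda>_. coord j 0 (T 0))"
        unfolding coord_def
        by (intro ext arg_cong[where f = "(*) _"] g_left_invariant X_left_invariant that)
      then show ?thesis
        using tangent_const[OF smooth_vfieldsD(1)[OF that(3)]] by simp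
    qed
    have "lie_bracket U V p =
        (\<Sum>i\<in>I. \<Sum>j\<in>I. (coord i p (U p) * coord j p (V p)) *\<^sub>R lie_bracket (X i) (X j) p)"
      using lie_bracket_expand[OF sm(1,2), of p] U V sm by (simp add: const)
    then have "g p (lie_bracket U V p) (W p) = (\<Sum>i\<in>I. \<Sum>j\<in>I.
        coord i p (U p) * coord j p (V p) * g p (lie_bracket (X i) (X j) p) (W p))"
      using Wp by (simp add: g_sum g_scale tangent_space_closed bracket_tangent)
    also have "\<dots> = (\<Sum>i\<in>I. \<Sum>j\<in>I. \<Sum>k\<in>I.
      coord i p (U p) * coord j p (V p) * coord k p (W p) * C i j k)"
      using Wp by (simp add: g_bracket_expand sum_distrib_left mult_ac)
    finally show ?thesis .
  qed
  show "killing_metric A g"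
    unfolding killing_metric_def
  proof (intro ballI allI)
    fix U V W p
    assume UVW: "U \<in> left_invariant_vfields A" "V \<in> left_invariant_vfields A" "W \<in> left_invariant_vfields A"
    \<comment> \<open>The second summation index is named \<open>k\<close> and the third
      \<open>j\<close>, so that \<open>j\<close> stays attached to \<open>V\<close> and
      \<open>k\<close> to \<open>W\<close>; only \<open>C\<close> then has its last two indices
      exchanged.\<close>
    have "g p (lie_bracket U W p) (V p) = (\<Sum>i\<in>I. \<Sum>k\<in>I. \<Sum>j\<in>I.
        - (coord i p (U p) * coord j p (V p) * coord k p (W p) * C i j k))"
      unfolding bracket[OF UVW(1,3,2)]
      by (intro sum.cong refl, subst C[rule_format]) (simp_all add: mult_ac)
    also have "\<dots> = (\<Sum>i\<in>I. \<Sum>j\<in>I. \<Sum>k\<in>I.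
        - (coord i p (U p) * coord j p (V p) * coord k p (W p) * C i j k))"
      by (rule sum.cong[OF refl], rule sum.swap)
    also have "\<dots> = - g p (lie_bracket U V p) (W p)"
      unfolding bracket[OF UVW] by (simp add: sum_negf)
    finally show "g p (lie_bracket U V p) (W p) + g p (lie_bracket U W p) (V p) = 0" by simp
  qed
qed

section \<open>The half-bracket connection\<close>

lemma smooth_vfields_add:
  "Y \<in> smooth_vfields A \<Longrightarrow> Z \<in> smooth_vfields A \<Longrightarrow> (\<lambda>p. Y p + Z p) \<in> smooth_vfields A"
  by (simp add: smooth_vfields_def tangent_space_closed(1) smooth_functions_add[OF atlas])

lemma smooth_vfields_scale:
  "f \<in> smooth_functions A \<Longrightarrow> Y \<in> smooth_vfields A \<Longrightarrow> (\<lambda>p. f p *\<^sub>R Y p) \<in> smooth_vfields A"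
  by (simp add: smooth_vfields_def tangent_space_closed(3) smooth_functions_mult[OF atlas])

lemma smooth_vfields_sum:
  "(\<And>j. j \<in> J \<Longrightarrow> Y j \<in> smooth_vfields A) \<Longrightarrow> (\<lambda>p. \<Sum>j\<in>J. Y j p) \<in> smooth_vfields A"
  by (simp add: smooth_vfields_def tangent_space_closed(5) sum_fun_apply smooth_functions_sum[OF atlas])

text \<open>The connection with \<open>\<nabla> (X i) (X j) = [X i, X j] / 2\<close>, extended by the Leibniz rule.\<close>

definition half_bracket_connection :: "'a connection"
  where "half_bracket_connection Y Z = (\<lambda>p.
    (\<Sum>j\<in>I. Y p (\<lambda>q. coord j q (Z q)) *\<^sub>R X j p)
    + (\<Sum>i\<in>I. \<Sum>j\<in>I. (coord i p (Y p) * coord j p (Z p) / 2) *\<^sub>R lie_bracket (X i) (X j) p))"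

lemma half_bracket_connection_smooth:
  assumes "Y \<in> smooth_vfields A" and "Z \<in> smooth_vfields A"
  shows "half_bracket_connection Y Z \<in> smooth_vfields A"
  unfolding half_bracket_connection_def divide_inverse
  by (intro smooth_vfields_add smooth_vfields_sum smooth_vfields_scale X_smooth bracket_smooth
      smooth_vfieldsD(2)[OF assms(1)] coord_smooth smooth_functions_mult[OF atlas]
      smooth_functions_const assms)

text \<open>Paired with a tangent vector, the brackets enter only through \<open>C\<close>, so
  metric compatibility and the tensor \<open>F\<close> become questions about index
  symmetries.\<close>

lemma g_half_bracket_connection:
  assumes "w \<in> tangent_space A p"
  shows "g p (half_bracket_connection Y Z p) w =
    (\<Sum>j\<in>I. \<epsilon> j * Y p (\<lambda>q. coord j q (Z q)) * coord j p w)
    + (\<Sum>i\<in>I. \<Sum>j\<in>I. \<Sum>k\<in>I. coord i p (Y p) * coord j p (Z p) * coord k p w * C i j k) / 2"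
proof -
  have "g p (X j p) w = \<epsilon> j * coord j p w" if "j \<in> I" for j
    using g_X[OF that] g_sym[OF X_tangent[OF that] assms] by simp
  then show ?thesis
    using assms unfolding half_bracket_connection_def
    by (simp add: g_add g_sum g_scale tangent_space_closed X_tangent bracket_tangent
        g_bracket_expand sum_distrib_left sum_divide_distrib mult_ac)
qed

lemma affine_half_bracket_connection: "affine_connection A half_bracket_connection"
  unfolding affine_connection_def
proof (intro conjI ballI)
  fix Y Z assume "Y \<in> smooth_vfields A" "Z \<in> smooth_vfields A"
  then show "half_bracket_connection Y Z \<in> smooth_vfields A"
    by (rule half_bracket_connection_smooth)
next
  fix Y Z W
  assume sm: "Y \<in> smooth_vfields A" "Z \<in> smooth_vfields A" "W \<in> smooth_vfields A"
  note tan = sm[THEN smooth_vfieldsD(1)]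
  show "half_bracket_connection (Y + Z) W = half_bracket_connection Y W + half_bracket_connection Z W"
    by (rule ext) (simp add: half_bracket_connection_def coord_add tan scaleR_add_left
        distrib_right add_divide_distrib sum.distrib)
  show "half_bracket_connection Y (Z + W) = half_bracket_connection Y Z + half_bracket_connection Y W"
    by (rule ext) (simp add: half_bracket_connection_def coord_add tan scaleR_add_left
        distrib_left add_divide_distrib sum.distrib tangent_add[OF tan(1)] coord_smooth sm)
next
  fix f Y Z
  assume f: "f \<in> smooth_functions A" and sm: "Y \<in> smooth_vfields A" "Z \<in> smooth_vfields A"
  note tan = sm[THEN smooth_vfieldsD(1)]
  show "half_bracket_connection (\<lambda>p. f p *\<^sub>R Y p) Z = (\<lambda>p. f p *\<^sub>R half_bracket_connection Y Z p)"
    by (rule ext) (simp add: half_bracket_connection_def coord_scale tan scaleR_add_right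
        scaleR_sum_right mult.assoc)
  show "half_bracket_connection Y (\<lambda>p. f p *\<^sub>R Z p)
      = (\<lambda>p. Y p f *\<^sub>R Z p + f p *\<^sub>R half_bracket_connection Y Z p)"
  proof
    fix p
    \<comment> \<open>Differentiating the coefficient \<open>f * coord j Z\<close> produces one
      extra sum with the factor \<open>Y p f\<close>; by \<open>expand\<close> it reassembles to
      \<open>Z\<close>.\<close>
    have "half_bracket_connection Y (\<lambda>p. f p *\<^sub>R Z p) p
        = (\<Sum>j\<in>I. (coord j p (Z p) * Y p f) *\<^sub>R X j p) + f p *\<^sub>R half_bracket_connection Y Z p"
      by (simp add: half_bracket_connection_def coord_scale tan scaleR_add_right scaleR_add_left
          scaleR_sum_right sum.distrib tangent_mult[OF tan(1)] f coord_smooth sm mult_ac)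
    also have "(\<Sum>j\<in>I. (coord j p (Z p) * Y p f) *\<^sub>R X j p) = Y p f *\<^sub>R (\<Sum>j\<in>I. coord j p (Z p) *\<^sub>R X j p)"
      by (simp add: scaleR_sum_right mult.commute)
    also have "(\<Sum>j\<in>I. coord j p (Z p) *\<^sub>R X j p) = Z p"
      using expand[OF tan(2)] by simp
    finally show "half_bracket_connection Y (\<lambda>p. f p *\<^sub>R Z p) p
        = Y p f *\<^sub>R Z p + f p *\<^sub>R half_bracket_connection Y Z p" .
  qed
qed

text \<open>Skewness of the bracket makes the two halves add up to the torsion-free condition;
  skewness of \<open>C\<close> in its last two indices, the Killing condition, gives compatibility
  with \<open>g\<close>.\<close>

lemma is_levi_civita_half_bracket_connection:
  assumes "killing_metric A g"
  shows "is_levi_civita A g half_bracket_connection"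
  unfolding is_levi_civita_def
proof (intro conjI ballI allI)
  show "affine_connection A half_bracket_connection"
    by (rule affine_half_bracket_connection)
next
  fix Y Z assume sm: "Y \<in> smooth_vfields A" "Z \<in> smooth_vfields A"
  show "half_bracket_connection Y Z - half_bracket_connection Z Y = lie_bracket Y Z"
  proof
    fix p
    let ?H = "\<lambda>Y Z. \<Sum>i\<in>I. \<Sum>j\<in>I. (coord i p (Y p) * coord j p (Z p) / 2) *\<^sub>R lie_bracket (X i) (X j) p"
    \<comment> \<open>Interchanging the two sums moves the exchange of \<open>Y\<close> and
      \<open>Z\<close> onto the frame bracket, which changes sign.\<close>
    have "?H Z Y
        = (\<Sum>i\<in>I. \<Sum>j\<in>I. - ((coord i p (Y p) * coord j p (Z p) / 2) *\<^sub>R lie_bracket (X i) (X j) p))"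
      by (subst sum.swap, intro sum.cong refl, subst lie_bracket_skew) (simp add: mult.commute)
    then have skew: "?H Z Y = - ?H Y Z"
      by (simp add: sum_negf)
    have double: "(\<Sum>i\<in>I. \<Sum>j\<in>I. (coord i p (Y p) * coord j p (Z p)) *\<^sub>R lie_bracket (X i) (X j) p)
        = ?H Y Z + ?H Y Z"
      by (simp add: sum.distrib[symmetric] scaleR_add_left[symmetric])
    show "(half_bracket_connection Y Z - half_bracket_connection Z Y) p = lie_bracket Y Z p"
      unfolding lie_bracket_expand[OF sm] double
      by (simp add: half_bracket_connection_def skew scaleR_diff_left sum_subtractf)
  qed
next
  fix U Y Z p
  assume sm: "U \<in> smooth_vfields A" "Y \<in> smooth_vfields A" "Z \<in> smooth_vfields A"
  note tan = sm[THEN smooth_vfieldsD(1)]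
  \<comment> \<open>Up to the factor 1/2, \<open>?S Y Z\<close> is the bracket part of \<nabla>_U Y
    paired with \<open>Z\<close>; its skewness in \<open>Y\<close> and \<open>Z\<close> removes it
    from the compatibility equation.\<close>
  let ?S = "\<lambda>Y Z. \<Sum>i\<in>I. \<Sum>j\<in>I. \<Sum>k\<in>I. coord i p (U p) * coord j p (Y p) * coord k p (Z p) * C i j k"
  have skew: "C i j k = - C i k j" if "i \<in> I" "j \<in> I" "k \<in> I" for i j k
    using assms that unfolding killing_metric_iff by blast
  have "?S Z Y = - ?S Y Z"
  proof -
    have "?S Z Y = (\<Sum>i\<in>I. \<Sum>k\<in>I. \<Sum>j\<in>I. coord i p (U p) * coord j p (Z p) * coord k p (Y p) * C i j k)"
      by (rule sum.cong[OF refl], rule sum.swap)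
    also have "\<dots> = (\<Sum>i\<in>I. \<Sum>k\<in>I. \<Sum>j\<in>I. - (coord i p (U p) * coord k p (Y p) * coord j p (Z p) * C i k j))"
      by (intro sum.cong refl, subst skew) (simp_all add: mult_ac)
    finally show ?thesis by (simp add: sum_negf)
  qed
  \<comment> \<open>In the orthonormal frame the metric has the constant coefficients
    \<open>\<epsilon> i\<close>, so only the coordinates of \<open>Y\<close> and \<open>Z\<close>
    get differentiated.\<close>
  moreover have "(\<lambda>q. g q (Y q) (Z q)) = (\<lambda>q. \<Sum>i\<in>I. \<epsilon> i * (coord i q (Y q) * coord i q (Z q)))"
    using tan by (simp add: g_expand mult.assoc)
  then have "U p (\<lambda>q. g q (Y q) (Z q)) = (\<Sum>i\<in>I. \<epsilon> i *
      (coord i p (Y p) * U p (\<lambda>q. coord i q (Z q)) + coord i p (Z p) * U p (\<lambda>q. coord i q (Y q))))"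
    by (simp add: tangent_sum[OF tan(1) atlas] tangent_scale[OF tan(1)] tangent_mult[OF tan(1)]
        smooth_functions_mult[OF atlas] smooth_functions_const coord_smooth sm)
  moreover have "g p (Y p) (half_bracket_connection U Z p) = g p (half_bracket_connection U Z p) (Y p)"
    by (intro g_sym tan smooth_vfieldsD(1)[OF half_bracket_connection_smooth] sm)
  ultimately show "U p (\<lambda>q. g q (Y q) (Z q))
      = g p (half_bracket_connection U Y p) (Z p) + g p (Y p) (half_bracket_connection U Z p)"
    using tan by (simp add: g_half_bracket_connection sum.distrib algebra_simps)
qed

text \<open>Three cyclic instances of compatibility, with torsion replaced by brackets, isolate one
  covariant derivative; the right-hand side does not mention \<open>D\<close>, which yields
  uniqueness.\<close>

lemma koszul_formula:
  assumes "is_levi_civita A g D"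
    and sm: "Y \<in> smooth_vfields A" "Z \<in> smooth_vfields A" "W \<in> smooth_vfields A"
  shows "2 * g p (D Y Z p) (W p) =
    Y p (\<lambda>q. g q (Z q) (W q)) + Z p (\<lambda>q. g q (W q) (Y q)) - W p (\<lambda>q. g q (Y q) (Z q))
    + g p (lie_bracket Y Z p) (W p) - g p (lie_bracket Z W p) (Y p) + g p (lie_bracket W Y p) (Z p)"
proof -
  have D: "D U V p \<in> tangent_space A p" if "U \<in> smooth_vfields A" "V \<in> smooth_vfields A" for U V
    using assms(1) that by (simp add: is_levi_civita_def affine_connection_def smooth_vfieldsD(1))
  note tan = sm[THEN smooth_vfieldsD(1)]
  \<comment> \<open>Symmetry of \<open>g\<close> puts every covariant derivative in the first slot,
    so that the terms in the Koszul formula cancel literally.\<close>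
  have compat: "U p (\<lambda>q. g q (V q) (T q)) = g p (D U V p) (T p) + g p (D U T p) (V p)"
    if "U \<in> smooth_vfields A" "V \<in> smooth_vfields A" "T \<in> smooth_vfields A" for U V T
  proof -
    have "U p (\<lambda>q. g q (V q) (T q)) = g p (D U V p) (T p) + g p (V p) (D U T p)"
      using assms(1) that unfolding is_levi_civita_def by blast
    also have "g p (V p) (D U T p) = g p (D U T p) (V p)"
      by (intro g_sym smooth_vfieldsD(1) D that)
    finally show ?thesis .
  qed
  have torsion: "g p (lie_bracket U V p) (T p) = g p (D U V p) (T p) - g p (D V U p) (T p)"
    if "U \<in> smooth_vfields A" "V \<in> smooth_vfields A" "T \<in> smooth_vfields A" for U V T
  proof -
    have "lie_bracket U V = D U V - D V U"
      using assms(1) that unfolding is_levi_civita_def by simp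
    then show ?thesis
      using that by (simp add: g_diff D smooth_vfieldsD(1))
  qed
  show ?thesis
    by (simp add: compat torsion sm)
qed

text \<open>Taking frame fields for \<open>W\<close> in the Koszul formula determines all
  coordinates of the covariant derivative.\<close>

lemma levi_civita_unique:
  assumes "is_levi_civita A g D" and "is_levi_civita A g E"
    and sm: "Y \<in> smooth_vfields A" "Z \<in> smooth_vfields A"
  shows "D Y Z = E Y Z"
proof
  fix p
  have "g p (D Y Z p) (X k p) = g p (E Y Z p) (X k p)" if "k \<in> I" for k
    using koszul_formula[OF assms(1) sm X_smooth[OF that], of p]
      koszul_formula[OF assms(2) sm X_smooth[OF that], of p] by simp
  then have "coord k p (D Y Z p) = coord k p (E Y Z p)" if "k \<in> I" for k
    using that by (simp add: coord_def)
  moreover have "D Y Z p \<in> tangent_space A p" "E Y Z p \<in> tangent_space A p"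
    using assms unfolding is_levi_civita_def affine_connection_def smooth_vfields_def by simp_all
  ultimately show "D Y Z p = E Y Z p"
    by (intro tangent_eqI)
qed

text \<open>The half-bracket connection witnesses that the choice in \<open>levi_civita\<close> is a
  genuine Levi-Civita connection; uniqueness then identifies the two on smooth fields.\<close>

lemma levi_civita_eq:
  assumes "killing_metric A g" and "Y \<in> smooth_vfields A" and "Z \<in> smooth_vfields A"
  shows "levi_civita A g Y Z = half_bracket_connection Y Z"
proof -
  note lc = is_levi_civita_half_bracket_connection[OF assms(1)]
  have "is_levi_civita A g (levi_civita A g)"
    unfolding levi_civita_def by (rule someI[where P = "is_levi_civita A g", OF lc])
  then show ?thesis
    by (rule levi_civita_unique[OF _ lc assms(2,3)])
qed

end

section \<open>Almost product structures diagonal in the frame\<close>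

text \<open>Two interchanges of adjacent sums make a cyclic shift; it brings the three terms of the
  cyclic sum of \<open>F\<close> to common index names.\<close>

lemma sum_rotate: "(\<Sum>i\<in>I. \<Sum>j\<in>I. \<Sum>k\<in>I. f j k i) = (\<Sum>i\<in>I. \<Sum>j\<in>I. \<Sum>k\<in>I. f i j k)"
proof -
  have "(\<Sum>i\<in>I. \<Sum>j\<in>I. \<Sum>k\<in>I. f j k i) = (\<Sum>j\<in>I. \<Sum>i\<in>I. \<Sum>k\<in>I. f j k i)"
    by (rule sum.swap)
  also have "\<dots> = (\<Sum>j\<in>I. \<Sum>k\<in>I. \<Sum>i\<in>I. f j k i)"
    by (rule sum.cong[OF refl], rule sum.swap)
  finally show ?thesis .
qed

locale diagonal_almost_product_frame = left_invariant_orthonormal_frame A I X g \<epsilon>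
  for A :: "('a::{t2_space,second_countable_topology,group_add}, 'e::euclidean_space) atlas"
    and I :: "'i set" and X g \<epsilon> +
  fixes P :: "'a tensor11" and \<sigma> :: "'i \<Rightarrow> real"
  assumes product: "almost_product_structure A P"
    and P_X: "i \<in> I \<Longrightarrow> P p (X i p) = \<sigma> i *\<^sub>R X i p"
    and sigma_sq [simp]: "i \<in> I \<Longrightarrow> \<sigma> i * \<sigma> i = 1"
begin

section \<open>The action of \<open>P\<close> on frame coordinates\<close>

lemma P_linear:
  "u \<in> tangent_space A p \<Longrightarrow> w \<in> tangent_space A p \<Longrightarrow>
    P p (a *\<^sub>R u + b *\<^sub>R w) = a *\<^sub>R P p u + b *\<^sub>R P p w"
  using product unfolding almost_product_structure_def tensor11_def by blast

lemma P_tangent: "u \<in> tangent_space A p \<Longrightarrow> P p u \<in> tangent_space A p"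
  using product unfolding almost_product_structure_def tensor11_def by blast

lemma P_smooth: "Y \<in> smooth_vfields A \<Longrightarrow> (\<lambda>p. P p (Y p)) \<in> smooth_vfields A"
  using product unfolding almost_product_structure_def tensor11_def by blast

lemma P_add:
  "u \<in> tangent_space A p \<Longrightarrow> w \<in> tangent_space A p \<Longrightarrow> P p (u + w) = P p u + P p w"
  using P_linear[of u p w 1 1] by simp

lemma P_scale: "u \<in> tangent_space A p \<Longrightarrow> P p (c *\<^sub>R u) = c *\<^sub>R P p u"
  using P_linear[of u p u c 0] by simp

lemma P_sum:
  assumes "\<And>j. j \<in> J \<Longrightarrow> f j \<in> tangent_space A p"
  shows "P p (sum f J) = (\<Sum>j\<in>J. P p (f j))"
  \<comment> \<open>Scaling by 0 shows that \<open>P p\<close> maps 0 to 0, which settles empty and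
    infinite index sets.\<close>
  using assms P_scale[OF tangent_space_closed(4), of p 0]
  by (induction J rule: infinite_finite_induct) (auto simp: P_add tangent_space_closed(5))

lemma coord_P:
  assumes "k \<in> I" and "u \<in> tangent_space A p"
  shows "coord k p (P p u) = \<sigma> k * coord k p u"
proof -
  have "P p u = P p (\<Sum>i\<in>I. coord i p u *\<^sub>R X i p)"
    using expand[OF assms(2)] by simp
  also have "\<dots> = (\<Sum>i\<in>I. (coord i p u * \<sigma> i) *\<^sub>R X i p)"
    by (simp add: P_sum P_scale P_X tangent_space_closed(3) X_tangent)
  finally have "g p (P p u) (X k p) = (\<Sum>i\<in>I. coord i p u * \<sigma> i * g p (X i p) (X k p))"
    using assms(1) by (simp add: g_sum g_scale tangent_space_closed(3) X_tangent)
  also have "\<dots> = (\<Sum>i\<in>I. if i = k then coord k p u * \<sigma> k * \<epsilon> k else 0)"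
    using assms(1) by (intro sum.cong) (auto simp: orthonormal)
  finally show ?thesis
    using assms(1) eps_sq[OF assms(1)] by (simp add: coord_def[of k p "P p u"])
qed

text \<open>\<open>P\<close> and \<open>g\<close> are diagonal in the same frame, so
  \<open>P\<close> is an isometry because its eigenvalues square to 1.\<close>

lemma almost_product_manifold: "almost_product_manifold A P g"
proof -
  have "g p (P p u) (P p w) = g p u w" if "u \<in> tangent_space A p" "w \<in> tangent_space A p" for p u w
  proof -
    have *: "\<epsilon> i * (\<sigma> i * a) * (\<sigma> i * b) = \<epsilon> i * a * b" if "i \<in> I" for i a b
      using sigma_sq[OF that] by algebra
    show ?thesis
      using that by (simp only: g_expand P_tangent coord_P * cong: sum.cong)
  qed
  then show ?thesis
    using atlas product metric by (simp add: almost_product_manifold_def)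
qed

text \<open>In the first term \<open>P\<close> acts on \<open>Z\<close> and contributes
  \<open>\<sigma> j\<close>; in the second it is moved onto \<open>W\<close> and contributes
  \<open>\<sigma> k\<close>. The derivative terms cancel because the eigenvalues are
  constant.\<close>

lemma F_tensor_killing:
  assumes K: "killing_metric A g"
    and sm: "Y \<in> smooth_vfields A" "Z \<in> smooth_vfields A" "W \<in> smooth_vfields A"
  shows "F_tensor A P g Y Z W p = (\<Sum>i\<in>I. \<Sum>j\<in>I. \<Sum>k\<in>I.
    coord i p (Y p) * coord j p (Z p) * coord k p (W p) * ((\<sigma> j - \<sigma> k) * C i j k)) / 2"
proof -
  let ?D = half_bracket_connection
  note tan = sm[THEN smooth_vfieldsD(1)]
  note PZ = P_smooth[OF sm(2)]
  have DYZ: "?D Y Z p \<in> tangent_space A p" "?D Y (\<lambda>p. P p (Z p)) p \<in> tangent_space A p"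
    by (intro smooth_vfieldsD(1)[OF half_bracket_connection_smooth] sm PZ)+
  \<comment> \<open>Being diagonal in an orthonormal frame, \<open>P\<close> is
    self-adjoint.\<close>
  have "g p (P p u) (W p) = g p u (P p (W p))" if "u \<in> tangent_space A p" for u
    using that tan by (simp add: g_expand P_tangent coord_P mult_ac)
  then have "F_tensor A P g Y Z W p = g p (?D Y (\<lambda>p. P p (Z p)) p) (W p) - g p (?D Y Z p) (P p (W p))"
    using sm PZ DYZ tan K
    by (simp add: F_tensor_def covariant_derivative_tensor11_def levi_civita_eq g_diff P_tangent)
  also have "\<dots> = (\<Sum>i\<in>I. \<Sum>j\<in>I. \<Sum>k\<in>I.
    coord i p (Y p) * coord j p (Z p) * coord k p (W p) * ((\<sigma> j - \<sigma> k) * C i j k)) / 2"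
    using tan
    by (simp add: g_half_bracket_connection P_tangent coord_P tangent_scale[OF tan(1)] coord_smooth sm
        sum_subtractf diff_divide_distrib algebra_simps)
  finally show ?thesis .
qed

lemma killing_imp_W3:
  assumes "killing_metric A g"
  shows "W3_manifold A P g"
  unfolding W3_manifold_def
proof (intro conjI ballI)
  show "almost_product_manifold A P g" by (rule almost_product_manifold)
next
  fix Y Z W
  assume sm: "Y \<in> smooth_vfields A" "Z \<in> smooth_vfields A" "W \<in> smooth_vfields A"
  show "F_tensor A P g Y Z W + F_tensor A P g Z W Y + F_tensor A P g W Y Z = 0"
  proof
    fix p
    define y z w where "y i = coord i p (Y p)" and "z i = coord i p (Z p)" and "w i = coord i p (W p)" for i
    have skew: "C i k j = - C i j k" "C j i k = - C i j k" if "i \<in> I" "j \<in> I" "k \<in> I" for i j k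
      using assms that C_skew unfolding killing_metric_iff by blast+
    \<comment> \<open>A cyclic permutation is a product of two transpositions: one is skewness of
      the bracket, the other the Killing condition.\<close>
    have cyc: "C j k i = C i j k" "C k i j = C i j k" if "i \<in> I" "j \<in> I" "k \<in> I" for i j k
      using skew[OF that] skew[OF that(2,3,1)] skew[OF that(3,1,2)] by linarith+
    let ?S = "\<lambda>c. \<Sum>i\<in>I. \<Sum>j\<in>I. \<Sum>k\<in>I. y i * z j * w k * (c i j k * C i j k)"
    have 1: "F_tensor A P g Y Z W p = ?S (\<lambda>i j k. \<sigma> j - \<sigma> k) / 2"
      using F_tensor_killing[OF assms sm] by (simp add: y_def z_def w_def)
    have "F_tensor A P g Z W Y p = (\<Sum>j\<in>I. \<Sum>k\<in>I. \<Sum>i\<in>I. y i * z j * w k * ((\<sigma> k - \<sigma> i) * C j k i)) / 2"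
      using F_tensor_killing[OF assms sm(2,3,1)] by (simp add: y_def z_def w_def mult_ac)
    also have "\<dots> = (\<Sum>i\<in>I. \<Sum>j\<in>I. \<Sum>k\<in>I. y i * z j * w k * ((\<sigma> k - \<sigma> i) * C j k i)) / 2"
      by (subst sum_rotate[symmetric]) (rule refl)
    also have "\<dots> = ?S (\<lambda>i j k. \<sigma> k - \<sigma> i) / 2"
      by (simp add: cyc)
    finally have 2: "F_tensor A P g Z W Y p = ?S (\<lambda>i j k. \<sigma> k - \<sigma> i) / 2" .
    have "F_tensor A P g W Y Z p = (\<Sum>k\<in>I. \<Sum>i\<in>I. \<Sum>j\<in>I. y i * z j * w k * ((\<sigma> i - \<sigma> j) * C k i j)) / 2"
      using F_tensor_killing[OF assms sm(3,1,2)] by (simp add: y_def z_def w_def mult_ac)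
    also have "\<dots> = (\<Sum>i\<in>I. \<Sum>j\<in>I. \<Sum>k\<in>I. y i * z j * w k * ((\<sigma> i - \<sigma> j) * C k i j)) / 2"
      by (subst sum_rotate) (rule refl)
    also have "\<dots> = ?S (\<lambda>i j k. \<sigma> i - \<sigma> j) / 2"
      by (simp add: cyc)
    finally have 3: "F_tensor A P g W Y Z p = ?S (\<lambda>i j k. \<sigma> i - \<sigma> j) / 2" .
    \<comment> \<open>Over common indices the coefficients \<open>\<sigma> j - \<sigma> k\<close>,
      \<open>\<sigma> k - \<sigma> i\<close> and \<open>\<sigma> i - \<sigma> j\<close> add up to
      0.\<close>
    have "?S (\<lambda>i j k. \<sigma> j - \<sigma> k) + ?S (\<lambda>i j k. \<sigma> k - \<sigma> i) + ?S (\<lambda>i j k. \<sigma> i - \<sigma> j) = 0"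
      by (simp add: sum.distrib[symmetric] distrib_left[symmetric] distrib_right[symmetric])
    then show "(F_tensor A P g Y Z W + F_tensor A P g Z W Y + F_tensor A P g W Y Z) p = 0 p"
      by (simp add: 1 2 3)
  qed
qed

end

section \<open>The four-dimensional group with signature (2,2)\<close>

theorem theorem4p1:
  fixes A :: "('a::{t2_space,second_countable_topology,group_add}, real^4) atlas"
    and X :: "nat \<Rightarrow> 'a vfield"
    and g :: "'a metric"
    and P :: "'a tensor11"
  assumes "lie_group A"
    and "connected (UNIV :: 'a set)"
    and "left_invariant_basis A {1..4} X"
    and "pseudo_riemannian_metric A g"
    and "left_invariant_metric A g"
    and "\<forall>p. g p (X 1 p) (X 1 p) = 1 \<and> g p (X 2 p) (X 2 p) = 1 \<and>
             - g p (X 3 p) (X 3 p) = 1 \<and> - g p (X 4 p) (X 4 p) = 1"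
    and "\<forall>p. \<forall>i\<in>{1..4}. \<forall>j\<in>{1..4}. i \<noteq> j \<longrightarrow> g p (X i p) (X j p) = 0"
    and "almost_product_structure A P"
    and "left_invariant_tensor11 A P"
    and "\<forall>p. P p (X 1 p) = X 1 p \<and> P p (X 2 p) = X 2 p \<and>
             P p (X 3 p) = - X 3 p \<and> P p (X 4 p) = - X 4 p"
  shows "W3_manifold A P g \<and> killing_metric A g \<longleftrightarrow>
    (\<exists>l1 l2 l3 l4 :: real.
       lie_bracket (X 1) (X 2) = l2 *\<^sub>R X 3 - l1 *\<^sub>R X 4 \<and>
       lie_bracket (X 1) (X 3) = l2 *\<^sub>R X 2 + l4 *\<^sub>R X 4 \<and>
       lie_bracket (X 1) (X 4) = - (l1 *\<^sub>R X 2) - l4 *\<^sub>R X 3 \<and>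
       lie_bracket (X 2) (X 3) = - (l2 *\<^sub>R X 1) - l3 *\<^sub>R X 4 \<and>
       lie_bracket (X 2) (X 4) = l1 *\<^sub>R X 1 + l3 *\<^sub>R X 3 \<and>
       lie_bracket (X 3) (X 4) = - (l4 *\<^sub>R X 1) + l3 *\<^sub>R X 2)"
proof -
  have I4: "{1..4} = {1, 2, 3, 4 :: nat}"
    by auto
  \<comment> \<open>One sign function serves twice: as the norms of the frame vectors and as the
    eigenvalues of \<open>P\<close>, which agree for all four indices.\<close>
  define \<epsilon> :: "nat \<Rightarrow> real" where "\<epsilon> i = (if i \<le> 2 then 1 else - 1)" for i
  interpret diagonal_almost_product_frame A "{1..4}" X g \<epsilon> P \<epsilon>
  proof
    show "smooth_atlas A"
      using assms(1) by (simp add: lie_group_def)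
    show "g p (X i p) (X j p) = (if i = j then \<epsilon> i else 0)" if "i \<in> {1..4}" "j \<in> {1..4}" for i j p
      using spec[OF assms(6), of p] spec[OF assms(7), of p] that
      by (cases "i = j") (auto simp: I4 \<epsilon>_def simp del: One_nat_def)
    show "P p (X i p) = \<epsilon> i *\<^sub>R X i p" if "i \<in> {1..4}" for i p
      using spec[OF assms(10), of p] that by (auto simp: I4 \<epsilon>_def simp del: One_nat_def)
  qed (use assms in \<open>simp_all add: \<epsilon>_def\<close>)
  have eps: "\<epsilon> 1 = 1" "\<epsilon> 2 = 1" "\<epsilon> 3 = -1" "\<epsilon> 4 = -1"
    by (simp_all add: \<epsilon>_def)
  have I: "1 \<in> {1..4::nat}" "2 \<in> {1..4::nat}" "3 \<in> {1..4::nat}" "4 \<in> {1..4::nat}"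
    by simp_all
  have diag: "C i i k = 0" if "i \<in> {1..4}" "k \<in> {1..4}" for i k
    using C_skew[OF that(1) that(1) that(2)] by simp
  \<comment> \<open>Since a Killing metric already gives the class \<open>W3\<close>, the table of
    brackets only has to be compared with the Killing condition.\<close>
  have "killing_metric A g \<longleftrightarrow> (\<exists>l1 l2 l3 l4 :: real.
       lie_bracket (X 1) (X 2) = l2 *\<^sub>R X 3 - l1 *\<^sub>R X 4 \<and>
       lie_bracket (X 1) (X 3) = l2 *\<^sub>R X 2 + l4 *\<^sub>R X 4 \<and>
       lie_bracket (X 1) (X 4) = - (l1 *\<^sub>R X 2) - l4 *\<^sub>R X 3 \<and>
       lie_bracket (X 2) (X 3) = - (l2 *\<^sub>R X 1) - l3 *\<^sub>R X 4 \<and>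
       lie_bracket (X 2) (X 4) = l1 *\<^sub>R X 1 + l3 *\<^sub>R X 3 \<and>
       lie_bracket (X 3) (X 4) = - (l4 *\<^sub>R X 1) + l3 *\<^sub>R X 2)"
    (is "_ \<longleftrightarrow> (\<exists>l1 l2 l3 l4. ?brackets l1 l2 l3 l4)")
  proof
    assume K: "killing_metric A g"
    have skew: "C i k j = - C i j k" if "i \<in> {1..4}" "j \<in> {1..4}" "k \<in> {1..4}" for i j k
      using K that unfolding killing_metric_iff by blast
    have zero: "C i j j = 0" "C i j i = 0" if "i \<in> {1..4}" "j \<in> {1..4}" for i j
      using skew[of i j j] skew[of i j i] diag[of i j] that by simp_all
    have cyc: "C j k i = C i j k" if "i \<in> {1..4}" "j \<in> {1..4}" "k \<in> {1..4}" for i j k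
      using skew[of j i k] C_skew[of i j k] that by simp
    have "lie_bracket (X i) (X j) = C i j 1 *\<^sub>R X 1 + C i j 2 *\<^sub>R X 2 - C i j 3 *\<^sub>R X 3 - C i j 4 *\<^sub>R X 4"
      if "i \<in> {1..4}" "j \<in> {1..4}" for i j
      unfolding bracket_expand[OF that] by (simp add: I4 eps del: One_nat_def)
    \<comment> \<open>The witnesses are read off from the coefficients of \<open>X 3\<close> and
      \<open>X 4\<close> in [\<open>X 1\<close>, \<open>X 2\<close>], and of \<open>X 4\<close> in
      [\<open>X 1\<close>, \<open>X 3\<close>] and [\<open>X 2\<close>, \<open>X 3\<close>]. The
      norm -1 of \<open>X 3\<close> and \<open>X 4\<close> accounts for the signs.\<close>
    then have "?brackets (C 1 2 4) (- C 1 2 3) (C 2 3 4) (- C 1 3 4)"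
      using skew[of 1 2 3] skew[of 1 2 4] skew[of 1 3 4] skew[of 2 3 4]
        cyc[of 1 2 3] cyc[of 1 2 4] cyc[of 1 3 4] cyc[of 2 3 4]
      by (simp add: I zero del: One_nat_def)
    then show "\<exists>l1 l2 l3 l4. ?brackets l1 l2 l3 l4"
      by blast
  next
    assume "\<exists>l1 l2 l3 l4. ?brackets l1 l2 l3 l4"
    then obtain l1 l2 l3 l4 where br: "?brackets l1 l2 l3 l4"
      by blast
    have C: "C i j k = g 0 (lie_bracket (X i) (X j) 0) (X k 0)" for i j k
      by (simp add: C_def)
    \<comment> \<open>The instance with scalar -1 says that negatives of tangent vectors at 0 are
      tangent, as needed for brackets that begin with a minus sign.\<close>
    note frame_simps = br C g_add g_diff g_minus g_scale orthonormal eps X_tangent tangent_space_closed(3) I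
      tangent_space_closed(3)[of _ 0 "- 1", simplified]
    have vals:
      "C 1 2 1 = 0" "C 1 2 2 = 0" "C 1 2 3 = - l2" "C 1 2 4 = l1"
      "C 1 3 1 = 0" "C 1 3 2 = l2" "C 1 3 3 = 0" "C 1 3 4 = - l4"
      "C 1 4 1 = 0" "C 1 4 2 = - l1" "C 1 4 3 = l4" "C 1 4 4 = 0"
      "C 2 3 1 = - l2" "C 2 3 2 = 0" "C 2 3 3 = 0" "C 2 3 4 = l3"
      "C 2 4 1 = l1" "C 2 4 2 = 0" "C 2 4 3 = - l3" "C 2 4 4 = 0"
      "C 3 4 1 = - l4" "C 3 4 2 = l3" "C 3 4 3 = 0" "C 3 4 4 = 0"
      by (simp_all add: frame_simps del: One_nat_def)
    \<comment> \<open>The table lists only brackets with increasing indices; \<open>rev\<close> and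
      \<open>diag\<close> supply the others, after which the Killing condition is a check over all
      index triples.\<close>
    have rev: "C 2 1 k = - C 1 2 k" "C 3 1 k = - C 1 3 k" "C 4 1 k = - C 1 4 k"
      "C 3 2 k = - C 2 3 k" "C 4 2 k = - C 2 4 k" "C 4 3 k = - C 3 4 k" if "k \<in> {1..4}" for k
      by (intro C_skew I that)+
    show "killing_metric A g"
      unfolding killing_metric_iff by (simp add: I4 vals rev[unfolded I4] diag[unfolded I4] del: One_nat_def)
  qed
  then show ?thesis
    using killing_imp_W3 by blast
qed

end
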